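(* Let $\nu>-1$, $t>0$, $0<\lambda<1$, $n\ge1$, and let $P_n(x;t,\lambda)$ be the orthonormal polynomials with respect to the weight $\omega_k=\rho_{k+\nu+1}(t)\lambda^k/k!$, $k\in\mathbb{N}_0$, with leading coefficients $a_n$ and recurrence coefficients $A_n=a_{n-1}/a_n$. Then, as an identity in $x$, $$P_n(x+1;t,\lambda)=P_n(x;t,\lambda)+\frac{A_n}{\lambda a_n}\frac{\partial a_n}{\partial t}P_{n-1}(x;t,\lambda)$$ $$+\frac1\lambda\sum_{k=0}^\infty\frac{\partial P_n}{\partial t}(k;t,\lambda)\frac{k\,\omega_k}{x-k+1}\Big[P_{n-1}(x;t,\lambda)\big[A_{n-1}P_{n-2}(k-1;t,\lambda)+(x-k+1)P_{n-1}(k-1;t,\lambda)\big]-A_{n-1}P_{n-2}(x;t,\lambda)P_{n-1}(k-1;t,\lambda)\Big].$$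
   Context: For $t>0$ and real $\mu$, $\rho_\mu(t)=2t^{\mu/2}K_\mu(2\sqrt t)$, where $K_\mu$ is the modified Bessel (Macdonald) function; for $\mu>0$, $\rho_\mu(t)=\int_0^\infty e^{-t/x-x}x^{\mu-1}dx$. The polynomials $P_n(x;t,\lambda)=a_nx^n+b_nx^{n-1}+\dots$ have real coefficients depending on $t,\lambda$ (and $\nu$), $\deg P_n=n$, and satisfy $\sum_{k=0}^\infty P_n(k;t,\lambda)P_m(k;t,\lambda)\,\omega_k=\delta_{n,m}$ for all $n,m\in\mathbb{N}_0$. They satisfy $xP_n=A_{n+1}P_{n+1}+B_nP_n+A_nP_{n-1}$ with $A_n=a_{n-1}/a_n$, $B_n=b_n/a_n-b_{n+1}/a_{n+1}$; conventions: $P_{-1}\equiv0$, $A_0=0$, $b_0=0$. Standing assumption: the coefficients of the $P_n$ are $C^1$ functions of $(t,\lambda)$ for $t>0$, $0<\lambda<1$. $\frac{\partial P_n}{\partial t}(k;t,\lambda)$ denotes the partial derivative in $t$ evaluated at $x=k$. For each $k$, the bracket vanishes at $x=k-1$, and its quotient by $x-k+1$ is understood as the resulting polynomial in $x$. *)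

theory Defs
  imports "HOL-Analysis.Analysis" "HOL-Computational_Algebra.Polynomial"
begin

text \<open>The modified Bessel function of the second kind (Macdonald function) of real order, through
  its standard integral representation, which converges for every real order when the argument
  is positive. Values at nonpositive arguments are irrelevant.\<close>

definition macdonald_K :: "real \<Rightarrow> real \<Rightarrow> real" where
  "macdonald_K \<mu> z = integral {0..} (\<lambda>u. exp (- z * cosh u) * cosh (\<mu> * u))"

definition rho :: "real \<Rightarrow> real \<Rightarrow> real" where
  "rho \<mu> t = 2 * t powr (\<mu> / 2) * macdonald_K \<mu> (2 * sqrt t)"

lemma rho_integral:
  fixes \<mu> t :: real
  assumes "\<mu> > 0" "t > 0"
  shows "(\<lambda>x. exp (- t / x - x) * x powr (\<mu> - 1)) absolutely_integrable_on {0<..}"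
    and "rho \<mu> t = integral {0<..} (\<lambda>x. exp (- t / x - x) * x powr (\<mu> - 1))"
proof -
  define f where "f = (\<lambda>x::real. exp (- t / x - x) * x powr (\<mu> - 1))"
  define s where "s = sqrt t"
  define h where "h = (\<lambda>u::real. s powr \<mu> * exp (\<mu> * u) * exp (- (2 * s) * cosh u))"
  have s: "s > 0" "s * s = t" using assms by (auto simp: s_def)
  have G: "(\<lambda>x. x powr (\<mu> - 1) / exp x) absolutely_integrable_on {0<..}"
  proof -
    have "((\<lambda>x::real. x powr (\<mu> - 1) / exp x) has_integral Gamma \<mu>) {0..}"
      using Gamma_integral_real assms by blast
    then have "(\<lambda>x::real. x powr (\<mu> - 1) / exp x) integrable_on {0..}" by blast
    then have "(\<lambda>x::real. x powr (\<mu> - 1) / exp x) absolutely_integrable_on {0..}"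
      by (intro nonnegative_absolutely_integrable_1) auto
    then show ?thesis
      by (rule set_integrable_subset) auto
  qed
  have "(\<lambda>x. exp (- t / x) * (x powr (\<mu> - 1) / exp x)) absolutely_integrable_on {0<..}"
  proof (rule absolutely_integrable_bounded_measurable_product_real[OF _ _ _ G])
    show "(\<lambda>x. exp (- t / x)) \<in> borel_measurable (lebesgue_on {0<..})"
      by (intro continuous_imp_measurable_on_sets_lebesgue continuous_intros) auto
    show "bounded ((\<lambda>x. exp (- t / x)) ` {0<..})"
      using assms by (intro boundedI[of _ 1]) auto
  qed auto
  moreover have "(\<lambda>x. exp (- t / x) * (x powr (\<mu> - 1) / exp x)) = f"
    by (auto simp: f_def exp_diff fun_eq_iff)
  ultimately have f: "f absolutely_integrable_on {0<..}" by simp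
  then show "(\<lambda>x. exp (- t / x - x) * x powr (\<mu> - 1)) absolutely_integrable_on {0<..}"
    by (simp add: f_def)
  have img: "range (\<lambda>u. s * exp u) = {0<..}"
  proof (intro equalityI subsetI)
    fix x :: real assume "x \<in> {0<..}"
    then have "x = s * exp (ln (x / s))" using s by simp
    then show "x \<in> range (\<lambda>u. s * exp u)" by blast
  qed (use s in auto)
  have heq: "\<bar>s * exp u\<bar> * f (s * exp u) = h u" for u
  proof -
    have 1: "s * exp u * (s * exp u) powr (\<mu> - 1) = s powr \<mu> * exp (\<mu> * u)"
    proof -
      have "s * exp u * (s * exp u) powr (\<mu> - 1) = (s * exp u) powr \<mu>"
        using s by (simp add: powr_mult_base)
      also have "\<dots> = s powr \<mu> * exp (\<mu> * u)"
        using s by (simp add: powr_def ln_mult_pos distrib_left exp_add)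
      finally show ?thesis .
    qed
    have 2: "- t / (s * exp u) - s * exp u = - (2 * s) * cosh u"
      using s by (simp add: cosh_def exp_minus field_simps flip: s(2))
    have "\<bar>s * exp u\<bar> * f (s * exp u)
        = (s * exp u * (s * exp u) powr (\<mu> - 1)) * exp (- t / (s * exp u) - s * exp u)"
      using s by (simp add: f_def abs_of_pos)
    then show ?thesis unfolding 1 2 h_def .
  qed
  have "(\<lambda>u. \<bar>s * exp u\<bar> * f (s * exp u)) absolutely_integrable_on UNIV \<and>
        integral UNIV (\<lambda>u. \<bar>s * exp u\<bar> * f (s * exp u)) = integral {0<..} f"
  proof (rule iffD2[OF has_absolute_integral_change_of_variables_1'[where f = f and g = "\<lambda>u. s * exp u"
      and g' = "\<lambda>u. s * exp u"]])
    show "UNIV \<in> sets (lebesgue :: real measure)" by simp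
    show "((\<lambda>u. s * exp u) has_field_derivative s * exp u) (at u within UNIV)" for u
      by (auto intro!: derivative_eq_intros)
    show "inj (\<lambda>u. s * exp u)" using s by (auto simp: inj_on_def)
    show "f absolutely_integrable_on range (\<lambda>u. s * exp u) \<and>
        integral (range (\<lambda>u. s * exp u)) f = integral {0<..} f"
      using f by (simp add: img)
  qed
  then have h: "h absolutely_integrable_on UNIV" "integral UNIV h = integral {0<..} f"
    by (simp_all add: heq)
  have hp: "h absolutely_integrable_on {0..}" and hn: "h absolutely_integrable_on {..0}"
    by (rule set_integrable_subset[OF h(1)]; simp)+
  have refl: "(\<lambda>u. h (- u)) absolutely_integrable_on {0..} \<and>
      integral {0..} (\<lambda>u. h (- u)) = integral {..0} h"
    by (subst has_absolute_integral_reflect_real[where B = "{..0}"]) (use hn in auto)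
  have "integral UNIV h = integral ({0..} \<union> {..0}) h"
    by (rule arg_cong[where f = "\<lambda>A. integral A h"]) auto
  also have "\<dots> = integral {0..} h + integral {..0} h"
  proof (rule Henstock_Kurzweil_Integration.integral_Un)
    have "{0..} \<inter> {..0::real} = {0}" by auto
    then show "negligible ({0..} \<inter> {..0::real})" by simp
  qed (use hp hn in \<open>auto simp: absolutely_integrable_on_def\<close>)
  also have "integral {..0} h = integral {0..} (\<lambda>u. h (- u))" using refl by simp
  also have "integral {0..} h + integral {0..} (\<lambda>u. h (- u)) = integral {0..} (\<lambda>u. h u + h (- u))"
    by (rule Henstock_Kurzweil_Integration.integral_add[symmetric])
       (use hp refl in \<open>auto simp: absolutely_integrable_on_def\<close>)
  also have "(\<lambda>u. h u + h (- u))
      = (\<lambda>u. (2 * s powr \<mu>) * (exp (- (2 * s) * cosh u) * cosh (\<mu> * u)))"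
  proof
    fix u
    have "exp (\<mu> * u) + exp (- (\<mu> * u)) = 2 * cosh (\<mu> * u)"
      by (simp add: cosh_field_def)
    then show "h u + h (- u) = (2 * s powr \<mu>) * (exp (- (2 * s) * cosh u) * cosh (\<mu> * u))"
      by (simp add: h_def flip: distrib_left distrib_right)
  qed
  also have "integral {0..} \<dots> = 2 * s powr \<mu> * macdonald_K \<mu> (2 * s)"
    by (simp add: macdonald_K_def)
  also have "s powr \<mu> = t powr (\<mu> / 2)"
    using assms by (simp add: s_def powr_half_sqrt[symmetric] powr_powr)
  finally show "rho \<mu> t = integral {0<..} (\<lambda>x. exp (- t / x - x) * x powr (\<mu> - 1))"
    using h(2) by (simp add: rho_def s_def f_def)
qed

definition weight :: "real \<Rightarrow> real \<Rightarrow> real \<Rightarrow> nat \<Rightarrow> real" where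
  "weight \<nu> t lam k = rho (real k + \<nu> + 1) t * lam ^ k / fact k"

text \<open>Continuous differentiability in the Frechet sense; meant for open sets.\<close>

definition C1_on :: "('a::real_normed_vector \<Rightarrow> 'b::real_normed_vector) \<Rightarrow> 'a set \<Rightarrow> bool" where
  "C1_on f S \<longleftrightarrow> (\<exists>f' :: 'a \<Rightarrow> 'a \<Rightarrow>\<^sub>L 'b. continuous_on S f' \<and>
     (\<forall>x\<in>S. (f has_derivative blinfun_apply (f' x)) (at x)))"

text \<open>For a sequence \<open>p\<close> of polynomials, \<open>prev p m\<close> is the polynomial of index \<open>m - 1\<close>, with the
  convention that the polynomial of index \<open>-1\<close> is zero.\<close>

definition prev :: "(nat \<Rightarrow> real poly) \<Rightarrow> nat \<Rightarrow> real poly" where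
  "prev p m = (case m of 0 \<Rightarrow> 0 | Suc j \<Rightarrow> p j)"

definition rec_A :: "(nat \<Rightarrow> real poly) \<Rightarrow> nat \<Rightarrow> real" where
  "rec_A p m = (case m of 0 \<Rightarrow> 0 | Suc j \<Rightarrow> lead_coeff (p j) / lead_coeff (p (Suc j)))"

text \<open>The bracket
  \<open>p\<^sub>m(x) [A\<^sub>m p\<^sub>m\<^sub>-\<^sub>1(y) + (x - y) p\<^sub>m(y)] - A\<^sub>m p\<^sub>m\<^sub>-\<^sub>1(x) p\<^sub>m(y)\<close>
  as a polynomial in \<open>x\<close>.\<close>

definition bracket :: "(nat \<Rightarrow> real poly) \<Rightarrow> nat \<Rightarrow> real \<Rightarrow> real poly" where
  "bracket p m y =
     p m * ([:rec_A p m * poly (prev p m) y:] + [:- y, 1:] * [:poly (p m) y:])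
     - [:rec_A p m:] * prev p m * [:poly (p m) y:]"

lemma poly_bracket:
  "poly (bracket p m y) x =
     poly (p m) x * (rec_A p m * poly (prev p m) y + (x - y) * poly (p m) y)
     - rec_A p m * poly (prev p m) x * poly (p m) y"
  by (simp add: bracket_def algebra_simps)

text \<open>The bracket vanishes at \<open>x = y\<close>, so the division with remainder below is exact.\<close>

lemma bracket_dvd: "[:- y, 1:] dvd bracket p m y"
  by (simp add: poly_eq_0_iff_dvd[symmetric] poly_bracket)

definition bracket_quot :: "(nat \<Rightarrow> real poly) \<Rightarrow> nat \<Rightarrow> real \<Rightarrow> real poly" where
  "bracket_quot p m y = bracket p m y div [:- y, 1:]"

lemma poly_bracket_quot:
  assumes "x \<noteq> y"
  shows "poly (bracket_quot p m y) x = poly (bracket p m y) x / (x - y)"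
proof -
  have "bracket p m y = bracket_quot p m y * [:- y, 1:]"
    using bracket_dvd by (simp only: bracket_quot_def dvd_div_mult_self)
  then have "poly (bracket p m y) x = poly (bracket_quot p m y * [:- y, 1:]) x"
    by (rule arg_cong)
  also have "\<dots> = poly (bracket_quot p m y) x * (x - y)"
    by (simp only: poly_mult) simp
  finally show ?thesis using assms by simp
qed

end

theory Submission
  imports Defs
begin

text \<open>
  Two facts combine. On the side of the weight, \<open>\<rho>\<^sub>\<mu>' = - \<rho>\<^bsub>\<mu>-1\<^esub>\<close>, so that
  \<open>k \<omega>\<^sub>k' = - \<lambda> \<omega>\<^bsub>k-1\<^esub>\<close> for \<open>k \<ge> 1\<close>: differentiating the weight in \<open>t\<close> shifts its index. On the
  side of the polynomials, the bracket divided by \<open>x - y\<close> is, by the Christoffel-Darboux formula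
  (\<open>bracket_quot_kernel\<close>), the kernel \<open>\<Sum>\<^bsub>j<n\<^esub> P\<^sub>j(x) P\<^sub>j(y)\<close>. Hence the series in the theorem is a
  linear combination of \<open>P\<^sub>0, \<dots>, P\<^bsub>n-1\<^esub>\<close>, and so is \<open>P\<^sub>n(x+1) - P\<^sub>n(x)\<close>; it remains to match the
  coefficients.

  Write \<open>\<langle>q\<rangle>\<^sub>s = \<Sum>\<^sub>k q(k) \<omega>\<^sub>k(s)\<close>. By orthogonality the coefficient of \<open>P\<^sub>j\<close> in \<open>P\<^sub>n(x+1) - P\<^sub>n(x)\<close> is
  \<open>c\<^sub>j = \<langle>P\<^sub>n(x+1) P\<^sub>j(x)\<rangle>\<^sub>t\<close>. Put \<open>r(x) = x P\<^sub>j(x-1;t)\<close> with \<open>t\<close> fixed, and compute the derivative of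
  \<open>F(s) = \<langle>P\<^sub>n(x;s) r(x)\<rangle>\<^sub>s\<close> at \<open>s = t\<close> in two ways. The product rule and the index shift of the
  weight (\<open>moment_has_derivative\<close>) give \<open>F'(t) = \<langle>(\<partial>P\<^sub>n/\<partial>t) r\<rangle>\<^sub>t - \<lambda> c\<^sub>j\<close>. But \<open>deg r = j + 1 \<le> n\<close>, so
  orthogonality gives \<open>F(s) = [x\<^sup>n] r / a\<^sub>n(s)\<close>, which is \<open>0\<close> for \<open>j < n - 1\<close> and
  \<open>a\<^bsub>n-1\<^esub>(t) / a\<^sub>n(s)\<close> for \<open>j = n - 1\<close>. Comparing,
  \<open>\<lambda> c\<^sub>j = \<langle>(\<partial>P\<^sub>n/\<partial>t) r\<rangle>\<^sub>t + \<delta>\<^bsub>j,n-1\<^esub> A\<^sub>n a\<^sub>n'/a\<^sub>n\<close>, and these are the coefficients in the theorem.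
\<close>

section \<open>The functions rho\<close>

lemma rho_has_integral:
  assumes "\<mu> > 0" "t > 0"
  shows "((\<lambda>x. exp (- t / x - x) * x powr (\<mu> - 1)) has_integral rho \<mu> t) {0<..}"
  using rho_integral[OF assms]
  by (simp add: absolutely_integrable_on_def has_integral_integrable_integral)

lemma rho_nonneg:
  assumes "\<mu> > 0" "t > 0"
  shows "rho \<mu> t \<ge> 0"
  by (rule has_integral_nonneg[OF rho_has_integral[OF assms]]) auto

lemma rho_antimono:
  assumes "\<mu> > 0" "0 < s" "s \<le> t"
  shows "rho \<mu> t \<le> rho \<mu> s"
proof (rule has_integral_le[OF rho_has_integral rho_has_integral])
  fix x :: real assume "x \<in> {0<..}"
  then show "exp (- t / x - x) * x powr (\<mu> - 1) \<le> exp (- s / x - x) * x powr (\<mu> - 1)"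
    using assms by (intro mult_right_mono) (auto simp: divide_right_mono)
qed (use assms in auto)

text \<open>The integrand \<open>e\<^bsup>-t/x-x\<^esup> x\<^bsup>\<mu>-1\<^esup>\<close> is convex in \<open>t\<close>. Convexity makes each \<open>\<rho>\<^sub>\<mu>\<close> continuous,
  so that the tangent inequality below suffices to differentiate under the integral sign.\<close>

lemma rho_convex:
  assumes "\<mu> > 0"
  shows "convex_on {0<..} (rho \<mu>)"
proof (rule convex_onI)
  fix u s t :: real
  assume u: "0 < u" "u < 1" and st: "s \<in> {0<..}" "t \<in> {0<..}"
  let ?f = "\<lambda>s x. exp (- s / x - x) * x powr (\<mu> - 1)"
  have pos: "(1 - u) * s + u * t > 0"
    using u st by (intro add_pos_pos mult_pos_pos) auto
  have "rho \<mu> ((1 - u) * s + u * t) \<le> (1 - u) * rho \<mu> s + u * rho \<mu> t"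
  proof (rule has_integral_le[OF rho_has_integral[OF assms pos]])
    show "((\<lambda>x. (1 - u) * ?f s x + u * ?f t x) has_integral (1 - u) * rho \<mu> s + u * rho \<mu> t) {0<..}"
      using st assms by (intro has_integral_add has_integral_mult_right rho_has_integral) auto
    fix x :: real assume "x \<in> {0<..}"
    have "exp ((1 - u) *\<^sub>R (- s / x - x) + u *\<^sub>R (- t / x - x))
        \<le> (1 - u) * exp (- s / x - x) + u * exp (- t / x - x)"
      by (rule convex_onD[OF exp_convex]) (use u in auto)
    also have "(1 - u) *\<^sub>R (- s / x - x) + u *\<^sub>R (- t / x - x) = - ((1 - u) * s + u * t) / x - x"
      using \<open>x \<in> {0<..}\<close> by (simp add: field_simps)
    finally have "exp (- ((1 - u) * s + u * t) / x - x) * x powr (\<mu> - 1)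
        \<le> ((1 - u) * exp (- s / x - x) + u * exp (- t / x - x)) * x powr (\<mu> - 1)"
      by (rule mult_right_mono) auto
    then show "?f ((1 - u) * s + u * t) x \<le> (1 - u) * ?f s x + u * ?f t x"
      by (simp add: algebra_simps)
  qed
  then show "rho \<mu> ((1 - u) *\<^sub>R s + u *\<^sub>R t) \<le> (1 - u) * rho \<mu> s + u * rho \<mu> t"
    by simp
qed auto

text \<open>Integrating the tangent inequality \<open>e\<^bsup>-s/x\<^esup> \<ge> e\<^bsup>-t/x\<^esup> (1 - (s - t)/x)\<close>; the factor \<open>1/x\<close>
  lowers the index \<open>\<mu>\<close> by one.\<close>

lemma rho_above_tangent:
  assumes "\<mu> > 1" "s > 0" "t > 0"
  shows "rho \<mu> s - rho \<mu> t \<ge> - (s - t) * rho (\<mu> - 1) t"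
proof (rule has_integral_le)
  show "((\<lambda>x. - (s - t) * (exp (- t / x - x) * x powr (\<mu> - 1 - 1))) has_integral
      - (s - t) * rho (\<mu> - 1) t) {0<..}"
    using assms by (intro has_integral_mult_right rho_has_integral) auto
  show "((\<lambda>x. exp (- s / x - x) * x powr (\<mu> - 1) - exp (- t / x - x) * x powr (\<mu> - 1))
      has_integral rho \<mu> s - rho \<mu> t) {0<..}"
    using assms by (intro has_integral_diff rho_has_integral) auto
  fix x :: real assume "x \<in> {0<..}"
  then have x: "x > 0" by simp
  have powr: "x powr (\<mu> - 1) = x * x powr (\<mu> - 1 - 1)"
    using x by (simp add: powr_mult_base)
  have "1 + - (s - t) / x \<le> exp (- (s - t) / x)"
    by (rule exp_ge_add_one_self)
  then have "exp (- t / x - x) * (1 + - (s - t) / x) \<le> exp (- t / x - x) * exp (- (s - t) / x)"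
    by (intro mult_left_mono) auto
  also have "\<dots> = exp (- s / x - x)"
    using x by (simp add: field_simps flip: exp_add)
  finally have "exp (- t / x - x) * (- (s - t) / x) \<le> exp (- s / x - x) - exp (- t / x - x)"
    by (simp add: algebra_simps)
  then have "exp (- t / x - x) * (- (s - t) / x) * (x * x powr (\<mu> - 1 - 1))
      \<le> (exp (- s / x - x) - exp (- t / x - x)) * (x * x powr (\<mu> - 1 - 1))"
    using x by (intro mult_right_mono) auto
  also have "exp (- t / x - x) * (- (s - t) / x) * (x * x powr (\<mu> - 1 - 1))
      = - (s - t) * (exp (- t / x - x) * x powr (\<mu> - 1 - 1))"
    using x by simp
  finally show "- (s - t) * (exp (- t / x - x) * x powr (\<mu> - 1 - 1))
      \<le> exp (- s / x - x) * x powr (\<mu> - 1) - exp (- t / x - x) * x powr (\<mu> - 1)"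
    unfolding powr by (simp only: left_diff_distrib)
qed

text \<open>The tangent inequality, used at \<open>t\<close> and at \<open>s\<close>, traps the difference quotient between
  \<open>- \<rho>\<^bsub>\<mu>-1\<^esub>(t)\<close> and \<open>- \<rho>\<^bsub>\<mu>-1\<^esub>(s)\<close>, and the latter converges to the former by continuity.\<close>

lemma rho_has_derivative:
  assumes "\<mu> > 1" "t > 0"
  shows "(rho \<mu> has_real_derivative - rho (\<mu> - 1) t) (at t)"
proof -
  let ?g = "rho (\<mu> - 1)"
  have "continuous_on {0<..} ?g"
    using assms by (intro convex_on_continuous rho_convex) auto
  then have "isCont ?g t"
    using assms by (simp add: continuous_on_eq_continuous_at)
  then have lim: "((\<lambda>s. \<bar>?g s - ?g t\<bar>) \<longlongrightarrow> 0) (at t)"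
    by (simp add: isCont_def LIM_zero_iff tendsto_rabs_zero)
  have "((\<lambda>s. (rho \<mu> s - rho \<mu> t) / (s - t) - - ?g t) \<longlongrightarrow> 0) (at t)"
  proof (rule Lim_null_comparison[OF _ lim])
    have "eventually (\<lambda>s. s \<in> {0<..}) (at t)"
      using assms by (intro eventually_at_in_open') auto
    then show "eventually (\<lambda>s. norm ((rho \<mu> s - rho \<mu> t) / (s - t) - - ?g t) \<le> \<bar>?g s - ?g t\<bar>) (at t)"
      using eventually_neq_at_within[of t t UNIV]
    proof eventually_elim
      case (elim s)
      define d where "d = rho \<mu> s - rho \<mu> t"
      have "- (s - t) * ?g t \<le> d" "d \<le> - (s - t) * ?g s"
        using rho_above_tangent[of \<mu> s t] rho_above_tangent[of \<mu> t s] elim assms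
        by (auto simp: d_def algebra_simps)
      then have "0 \<le> d + (s - t) * ?g t" "d + (s - t) * ?g t \<le> - (s - t) * (?g s - ?g t)"
        by (auto simp: algebra_simps)
      then have "\<bar>d + (s - t) * ?g t\<bar> \<le> \<bar>s - t\<bar> * \<bar>?g s - ?g t\<bar>"
        using abs_ge_self[of "- (s - t) * (?g s - ?g t)"]
        by (simp only: abs_mult abs_minus_cancel abs_of_nonneg)
      then have "\<bar>d + (s - t) * ?g t\<bar> / \<bar>s - t\<bar> \<le> \<bar>?g s - ?g t\<bar>"
        using elim by (subst pos_divide_le_eq) (auto simp: mult.commute)
      moreover have "d / (s - t) - - ?g t = (d + (s - t) * ?g t) / (s - t)"
        using elim by (simp add: field_simps)
      ultimately show ?case
        unfolding d_def[symmetric] by (simp only: real_norm_def abs_divide)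
    qed
  qed
  then show ?thesis
    unfolding has_field_derivative_iff by (rule LIM_zero_cancel)
qed


section \<open>Derivatives of moments\<close>

lemma weight_nonneg:
  assumes "\<nu> > -1" "s > 0" "lam > 0"
  shows "weight \<nu> s lam k \<ge> 0"
  unfolding weight_def using assms by (intro divide_nonneg_nonneg mult_nonneg_nonneg rho_nonneg) auto

lemma weight_antimono:
  assumes "\<nu> > -1" "0 < s" "s \<le> t" "lam > 0"
  shows "weight \<nu> t lam k \<le> weight \<nu> s lam k"
  unfolding weight_def using assms
  by (intro divide_right_mono mult_right_mono rho_antimono) auto

text \<open>\<open>(k + 1) \<omega>\<^bsub>k+1\<^esub>' = - \<lambda> \<omega>\<^sub>k\<close>: the step of \<open>\<rho>'\<close> down in its index, the power of \<open>\<lambda>\<close> and the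
  factorial combine into the weight of the preceding index.\<close>

lemma weight_has_derivative:
  assumes "\<nu> > -1" "s > 0"
  shows "((\<lambda>s. real (Suc k) * weight \<nu> s lam (Suc k)) has_real_derivative - lam * weight \<nu> s lam k) (at s)"
proof -
  have "((\<lambda>s. rho (real (Suc k) + \<nu> + 1) s * (lam * lam ^ k / fact k))
      has_real_derivative - rho (real (Suc k) + \<nu> + 1 - 1) s * (lam * lam ^ k / fact k)) (at s)"
    using assms by (intro DERIV_cmult_right rho_has_derivative) auto
  moreover have "real (Suc k) * weight \<nu> s lam (Suc k)
      = rho (real (Suc k) + \<nu> + 1) s * (lam * lam ^ k / fact k)" for s
    by (simp add: weight_def divide_simps del: of_nat_Suc)
  moreover have "- rho (real (Suc k) + \<nu> + 1 - 1) s * (lam * lam ^ k / fact k) = - lam * weight \<nu> s lam k"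
    by (simp add: weight_def add_ac)
  ultimately show ?thesis
    by simp
qed

text \<open>The series is differentiated term by term. Because the weight decreases in \<open>s\<close>, the terms of
  the derived series on \<open>[t/2, \<infinity>)\<close> are dominated by their values at \<open>t/2\<close>. The factor \<open>x\<close> in
  front of \<open>q\<close> removes the term \<open>k = 0\<close>, where the index shift fails.\<close>

lemma moment_has_derivative:
  assumes nu: "\<nu> > -1" and lam: "lam > 0" and t: "t > 0"
    and summable: "\<And>s r. s > 0 \<Longrightarrow> summable (\<lambda>k. poly r (real k) * weight \<nu> s lam k)"
  shows "((\<lambda>s. \<Sum>k. poly ([:0, 1:] * q) (real k) * weight \<nu> s lam k) has_real_derivative
           - lam * (\<Sum>k. poly (pcompose q [:1, 1:]) (real k) * weight \<nu> t lam k)) (at t)"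
proof -
  define Q where "Q k = poly q (real k + 1)" for k :: nat
  let ?f = "\<lambda>k s. Q k * (real (Suc k) * weight \<nu> s lam (Suc k))"
  let ?f' = "\<lambda>k s. Q k * (- lam * weight \<nu> s lam k)"
  let ?S = "{t / 2..} :: real set"
  have f_summable: "summable (\<lambda>k. ?f k s)" if "s > 0" for s
    using summable_Suc_iff[of "\<lambda>k. poly ([:0, 1:] * q) (real k) * weight \<nu> s lam k"]
      summable[OF that, of "[:0, 1:] * q"]
    by (simp add: Q_def mult_ac add.commute)
  have shift: "(\<Sum>k. poly ([:0, 1:] * q) (real k) * weight \<nu> s lam k) = (\<Sum>k. ?f k s)" if "s > 0" for s
    using suminf_split_head[OF summable[OF that, of "[:0, 1:] * q"]]
    by (simp add: Q_def mult_ac add.commute)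
  have "uniformly_convergent_on ?S (\<lambda>n s. \<Sum>k<n. ?f' k s)"
  proof (rule Weierstrass_m_test')
    \<comment> \<open>\<open>1 + \<bar>Q\<bar>\<^sup>2\<close> is a polynomial that bounds \<open>\<bar>Q\<bar>\<close>, so the hypothesis on polynomials
      yields the summable majorant.\<close>
    let ?r = "1 + pcompose q [:1, 1:] ^ 2"
    show "summable (\<lambda>k. lam * (poly ?r (real k) * weight \<nu> (t / 2) lam k))"
      using summable[of "t / 2" ?r] t by (intro summable_mult) auto
    fix k s assume s: "s \<in> ?S"
    have "0 \<le> (\<bar>Q k\<bar> - 1)\<^sup>2"
      by simp
    then have "\<bar>Q k\<bar> \<le> 1 + \<bar>Q k\<bar>\<^sup>2"
      by (simp add: power2_diff)
    also have "\<dots> = poly ?r (real k)"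
      by (simp add: Q_def poly_pcompose add.commute)
    finally have "\<bar>Q k\<bar> * weight \<nu> s lam k \<le> poly ?r (real k) * weight \<nu> (t / 2) lam k"
      using s t nu lam by (intro mult_mono weight_antimono weight_nonneg) auto
    then show "norm (?f' k s) \<le> lam * (poly ?r (real k) * weight \<nu> (t / 2) lam k)"
      using weight_nonneg[OF nu _ lam, of s k] s t lam
      by (simp add: abs_mult mult.left_commute)
  qed
  then have "((\<lambda>s. \<Sum>k. ?f k s) has_real_derivative (\<Sum>k. ?f' k t)) (at t)"
  proof (rule has_field_derivative_series'(2)[rotated 2])
    show "convex ?S" by simp
    show "(?f k has_real_derivative ?f' k s) (at s within ?S)" if "s \<in> ?S" for k s
      using that t nu
      by (intro DERIV_cmult has_field_derivative_at_within[OF weight_has_derivative]) auto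
    show "t \<in> ?S" "summable (\<lambda>k. ?f k t)" "t \<in> interior ?S"
      using t f_summable by (auto simp: interior_real_atLeast)
  qed
  also have "(\<Sum>k. ?f' k t) = - lam * (\<Sum>k. poly (pcompose q [:1, 1:]) (real k) * weight \<nu> t lam k)"
    using suminf_mult[OF summable[OF t, of "pcompose q [:1, 1:]"], of "- lam"]
    by (simp add: Q_def poly_pcompose mult_ac add.commute)
  finally have "((\<lambda>s. \<Sum>k. ?f k s) has_real_derivative
      - lam * (\<Sum>k. poly (pcompose q [:1, 1:]) (real k) * weight \<nu> t lam k)) (at t)" .
  then show ?thesis
    by (rule has_field_derivative_transform_within_open[of _ _ _ "{0<..}"])
       (simp_all only: open_greaterThan greaterThan_iff t shift)
qed


section \<open>Orthonormal polynomials\<close>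

locale orthonormal_polys =
  fixes p :: "nat \<Rightarrow> real poly" and w :: "nat \<Rightarrow> real"
  assumes degree_p: "degree (p i) = i"
    and orthonormal: "(\<lambda>k. poly (p i) (real k) * poly (p j) (real k) * w k) sums (if i = j then 1 else 0)"
begin

text \<open>The moment functional of the weight. On polynomials the series converges
  (\<open>poly_summable\<close>), so it is linear there.\<close>

definition L :: "real poly \<Rightarrow> real" where
  "L q = (\<Sum>k. poly q (real k) * w k)"

lemma p_nonzero: "p i \<noteq> 0"
  using orthonormal[of i i] sums_unique2[of "\<lambda>_. 0 :: real" 0 1] by auto

lemma lead_coeff_nonzero: "coeff (p i) i \<noteq> 0"
  using p_nonzero[of i] degree_p[of i] by (metis leading_coeff_0_iff)

lemma p_spans:
  assumes "degree q \<le> m"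
  shows "\<exists>c. q = (\<Sum>j\<le>m. smult (c j) (p j))"
  using assms
proof (induction m arbitrary: q)
  case 0
  then have "q = smult (coeff q 0 / coeff (p 0) 0) (p 0)"
    using degree_p[of 0] lead_coeff_nonzero[of 0]
    by (metis degree_0_id le_zero_eq nonzero_eq_divide_eq smult_pCons smult_0_right)
  then show ?case by (intro exI[of _ "\<lambda>_. coeff q 0 / coeff (p 0) 0"]) simp
next
  case (Suc m)
  let ?a = "coeff q (Suc m) / coeff (p (Suc m)) (Suc m)"
  have "degree (q - smult ?a (p (Suc m))) \<le> m"
  proof (rule degree_le, intro allI impI)
    fix i assume "m < i"
    show "coeff (q - smult ?a (p (Suc m))) i = 0"
    proof (cases "i = Suc m")
      case True
      then show ?thesis using lead_coeff_nonzero[of "Suc m"] by simp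
    next
      case False
      then show ?thesis
        using \<open>m < i\<close> Suc.prems degree_p[of "Suc m"] by (simp add: coeff_eq_0)
    qed
  qed
  from Suc.IH[OF this] obtain c where c: "q - smult ?a (p (Suc m)) = (\<Sum>j\<le>m. smult (c j) (p j))"
    by blast
  have "q = (\<Sum>j\<le>m. smult (c j) (p j)) + smult ?a (p (Suc m))"
    by (simp only: c[symmetric] diff_add_cancel)
  then have "q = (\<Sum>j\<le>Suc m. smult ((c(Suc m := ?a)) j) (p j))"
    by simp
  then show ?case by (rule exI[where x = "c(Suc m := ?a)"])
qed

text \<open>Orthonormality contains the convergence of \<open>\<Sum>\<^sub>k p\<^sub>j(k) p\<^sub>0(k) w\<^sub>k\<close>; as \<open>p\<^sub>0\<close> is a nonzero
  constant and the \<open>p\<^sub>j\<close> span all polynomials, every polynomial is summable against \<open>w\<close>.\<close>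

lemma poly_summable: "summable (\<lambda>k. poly q (real k) * w k)"
proof -
  obtain b where b: "p 0 = [:b:]"
    using degree_p[of 0] degree_eq_zeroE by blast
  then have "b \<noteq> 0" using p_nonzero[of 0] by auto
  obtain c where c: "smult (inverse b) q = (\<Sum>j\<le>degree q. smult (c j) (p j))"
    using p_spans[OF degree_smult_le[of "inverse b" q]] by (elim exE)
  have q: "q = (\<Sum>j\<le>degree q. smult (c j) (p j * p 0))"
  proof -
    have "q = smult b (smult (inverse b) q)"
      using \<open>b \<noteq> 0\<close> by simp
    also have "\<dots> = (\<Sum>j\<le>degree q. smult (c j) (p j)) * p 0"
      unfolding c b by simp
    finally show ?thesis by (simp add: sum_distrib_right)
  qed
  have "poly q (real k) * w k
      = (\<Sum>j\<le>degree q. c j * (poly (p j) (real k) * poly (p 0) (real k) * w k))" for k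
    using arg_cong[OF q, of "\<lambda>q. poly q (real k)"]
    by (simp only: poly_sum poly_smult poly_mult sum_distrib_right mult.assoc)
  moreover have "summable (\<lambda>k. \<Sum>j\<le>degree q. c j * (poly (p j) (real k) * poly (p 0) (real k) * w k))"
    using orthonormal by (intro summable_sum summable_mult) (auto simp: summable_def)
  ultimately show ?thesis by simp
qed

lemma L_add: "L (q + r) = L q + L r"
  using suminf_add[OF poly_summable[of q] poly_summable[of r]]
  by (simp add: L_def distrib_right)

lemma L_smult: "L (smult c q) = c * L q"
  using suminf_mult[OF poly_summable[of q], of c] by (simp add: L_def mult.assoc)

lemma L_sum: "L (\<Sum>i\<in>A. f i) = (\<Sum>i\<in>A. L (f i))"
proof (induction A rule: infinite_finite_induct)
  case (insert x A)
  then show ?case by (simp add: L_add)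
qed (auto simp: L_def)

lemma L_orthonormal: "L (p i * p j) = (if i = j then 1 else 0)"
  using orthonormal[of i j] by (simp add: L_def sums_iff)

lemma fourier_expansion:
  assumes "degree q \<le> m"
  shows "q = (\<Sum>j\<le>m. smult (L (q * p j)) (p j))"
proof -
  obtain c where c: "q = (\<Sum>j\<le>m. smult (c j) (p j))"
    using p_spans[OF assms] by blast
  have "L (q * p i) = c i" if "i \<le> m" for i
    unfolding c using that
    by (simp add: sum_distrib_right L_sum L_smult L_orthonormal if_distrib cong: if_cong)
  then have "(\<Sum>j\<le>m. smult (L (q * p j)) (p j)) = (\<Sum>j\<le>m. smult (c j) (p j))"
    by (intro sum.cong) auto
  then show ?thesis using c by simp
qed

text \<open>In the expansion of \<open>q\<close> only \<open>p\<^sub>m\<close> contributes to the coefficient of \<open>x\<^sup>m\<close>. For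
  \<open>degree q < m\<close> this is the orthogonality of \<open>p\<^sub>m\<close> to all polynomials of lower degree.\<close>

lemma L_mult_p:
  assumes "degree q \<le> m"
  shows "L (q * p m) = coeff q m / coeff (p m) m"
proof -
  have "coeff q m = coeff (\<Sum>j\<le>m. smult (L (q * p j)) (p j)) m"
    using fourier_expansion[OF assms] by simp
  also have "\<dots> = (\<Sum>j\<le>m. L (q * p j) * coeff (p j) m)"
    by (simp add: coeff_sum)
  also have "\<dots> = (\<Sum>j\<in>{m}. L (q * p j) * coeff (p j) m)"
    by (rule sum.mono_neutral_right) (auto simp: coeff_eq_0 degree_p)
  finally show ?thesis using lead_coeff_nonzero[of m] by simp
qed

lemma rec_A_Suc: "rec_A p (Suc m) = coeff (p m) m / coeff (p (Suc m)) (Suc m)"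
  by (simp add: rec_A_def degree_p)

lemma L_X_mult_p: "L ([:0, 1:] * p m * p (Suc m)) = rec_A p (Suc m)"
  using L_mult_p[of "[:0, 1:] * p m" "Suc m"] degree_p[of m]
  by (simp add: rec_A_Suc degree_pCons_le flip: degree_p)

text \<open>In the expansion of \<open>x p\<^sub>m\<close> the coefficient \<open>L(x p\<^sub>m p\<^sub>j) = L(p\<^sub>m (x p\<^sub>j))\<close> vanishes if
  \<open>j + 1 < m\<close>, and the two outer coefficients are both of the form \<open>L(x p\<^sub>i p\<^bsub>i+1\<^esub>) = A\<^bsub>i+1\<^esub>\<close>.\<close>

lemma three_term_recurrence:
  "\<exists>B. [:0, 1:] * p m = smult (rec_A p (Suc m)) (p (Suc m)) + smult B (p m)
        + smult (rec_A p m) (prev p m)"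
proof -
  let ?c = "\<lambda>j. L ([:0, 1:] * p m * p j)"
  have "degree ([:0, 1:] * p m) \<le> Suc m"
    using degree_mult_le[of "[:0, 1:]" "p m"] degree_p[of m] by simp
  from fourier_expansion[OF this]
  have "[:0, 1:] * p m = (\<Sum>j\<le>Suc m. smult (?c j) (p j))" .
  also have "\<dots> = smult (?c (Suc m)) (p (Suc m)) + smult (?c m) (p m) + (\<Sum>j<m. smult (?c j) (p j))"
    by (simp add: lessThan_Suc_atMost[symmetric] add_ac)
  also have "(\<Sum>j<m. smult (?c j) (p j)) = smult (rec_A p m) (prev p m)"
  proof (cases m)
    case 0
    then show ?thesis by (simp add: rec_A_def)
  next
    case (Suc l)
    have "?c j = 0" if "j < l" for j
    proof -
      have "degree ([:0, 1:] * p j) < m"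
        using degree_mult_le[of "[:0, 1:]" "p j"] degree_p[of j] that Suc by simp
      then have "L ([:0, 1:] * p j * p m) = 0"
        by (subst L_mult_p) (auto simp: coeff_eq_0)
      then show ?thesis by (simp add: mult_ac)
    qed
    moreover have "?c l = rec_A p m"
      using L_X_mult_p[of l] Suc by (simp add: mult_ac)
    ultimately show ?thesis by (simp add: Suc prev_def)
  qed
  finally show ?thesis unfolding L_X_mult_p by (rule exI)
qed

text \<open>The Christoffel-Darboux formula, with the terms of index \<open>m\<close> kept apart: the bracket is
  \<open>A\<^sub>m (p\<^sub>m(x) p\<^bsub>m-1\<^esub>(y) - p\<^bsub>m-1\<^esub>(x) p\<^sub>m(y)) + (x - y) p\<^sub>m(x) p\<^sub>m(y)\<close>. By the recurrence its antisymmetric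
  part for \<open>m + 1\<close> equals the whole bracket for \<open>m\<close>, so the sum telescopes.\<close>

lemma christoffel_darboux:
  "poly (bracket p m y) x = (x - y) * (\<Sum>j\<le>m. poly (p j) x * poly (p j) y)"
proof (induction m)
  case 0
  then show ?case by (simp add: poly_bracket rec_A_def)
next
  case (Suc m)
  obtain B where B: "[:0, 1:] * p m = smult (rec_A p (Suc m)) (p (Suc m)) + smult B (p m)
        + smult (rec_A p m) (prev p m)"
    using three_term_recurrence by blast
  have rec: "z * poly (p m) z = rec_A p (Suc m) * poly (p (Suc m)) z + B * poly (p m) z
        + rec_A p m * poly (prev p m) z" for z
    using arg_cong[OF B, of "\<lambda>q. poly q z"] by simp
  have "(x - y) * poly (p m) x * poly (p m) y
      = (x * poly (p m) x) * poly (p m) y - poly (p m) x * (y * poly (p m) y)"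
    by (simp add: algebra_simps)
  also have "\<dots> = rec_A p (Suc m) * (poly (p (Suc m)) x * poly (p m) y - poly (p m) x * poly (p (Suc m)) y)
      + rec_A p m * (poly (prev p m) x * poly (p m) y - poly (p m) x * poly (prev p m) y)"
    unfolding rec by (simp add: algebra_simps)
  finally have "poly (bracket p (Suc m) y) x
      = poly (bracket p m y) x + (x - y) * poly (p (Suc m)) x * poly (p (Suc m)) y"
    by (simp add: poly_bracket prev_def algebra_simps)
  then show ?case
    using Suc.IH by (simp add: algebra_simps)
qed

lemma bracket_quot_kernel:
  "poly (bracket_quot p m y) x = (\<Sum>j\<le>m. poly (p j) x * poly (p j) y)"
proof -
  let ?K = "\<Sum>j\<le>m. smult (poly (p j) y) (p j)"
  have "bracket p m y = ?K * [:- y, 1:]"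
    by (rule poly_eq_poly_eq_iff[THEN iffD1], rule ext)
       (simp add: christoffel_darboux poly_sum algebra_simps)
  then have "bracket_quot p m y = ?K"
    unfolding bracket_quot_def
    by (metis nonzero_mult_div_cancel_right one_neq_zero pCons_eq_0_iff)
  then show ?thesis by (simp add: poly_sum mult.commute)
qed

text \<open>The shift \<open>x \<mapsto> x + 1\<close> preserves the leading coefficient, so the coefficient of \<open>p\<^sub>n\<close> is 1.\<close>

lemma shift_expansion:
  "pcompose (p n) [:1, 1:] = p n + (\<Sum>j<n. smult (L (pcompose (p n) [:1, 1:] * p j)) (p j))"
proof -
  let ?q = "pcompose (p n) [:1, 1:]"
  have "degree ?q = n"
    by (simp add: degree_pcompose degree_p)
  moreover have "coeff ?q n = coeff (p n) n"
    using lead_coeff_comp[of "[:1, 1:]" "p n"] \<open>degree ?q = n\<close> by (simp add: degree_p)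
  ultimately have "L (?q * p n) = 1"
    using L_mult_p[of ?q n] lead_coeff_nonzero[of n] by simp
  moreover have "?q = (\<Sum>j\<le>n. smult (L (?q * p j)) (p j))"
    using \<open>degree ?q = n\<close> by (intro fourier_expansion) simp
  ultimately show ?thesis
    by (simp add: lessThan_Suc_atMost[symmetric])
qed

end


section \<open>The difference equation\<close>

lemma C1_on_partial_derivative:
  fixes f :: "real \<Rightarrow> real \<Rightarrow> real"
  assumes "C1_on (\<lambda>(s, q). f s q) S" "(t, q) \<in> S"
  shows "(\<lambda>s. f s q) differentiable (at t)"
proof -
  obtain f' where "((\<lambda>(s, q). f s q) has_derivative blinfun_apply (f' (t, q))) (at (t, q))"
    using assms unfolding C1_on_def by blast
  moreover have "((\<lambda>s. (s, q)) has_derivative (\<lambda>h. (h, 0))) (at t)"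
    by (auto intro!: derivative_eq_intros)
  ultimately have "((\<lambda>(s, q). f s q) \<circ> (\<lambda>s. (s, q)) has_derivative
      blinfun_apply (f' (t, q)) \<circ> (\<lambda>h. (h, 0))) (at t)"
    by (intro diff_chain_at) auto
  then show ?thesis
    unfolding differentiable_def o_def by auto
qed

lemma mult_as_sum_of_monoms:
  fixes q r :: "'a :: comm_ring_1 poly"
  assumes "degree q \<le> n"
  shows "q * r = (\<Sum>i\<le>n. smult (coeff q i) (monom 1 i * r))"
proof -
  have "q * r = (\<Sum>i\<le>n. monom (coeff q i) i) * r"
    using poly_as_sum_of_monoms'[OF assms] by simp
  then show ?thesis
    by (simp only: sum_distrib_right mult_smult_left[symmetric] smult_monom mult_1_right)
qed

theorem theorem2:
  fixes \<nu> t lam :: real and n :: nat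
    and P :: "nat \<Rightarrow> real \<Rightarrow> real \<Rightarrow> real poly"
  assumes nu: "\<nu> > -1"
    and deg: "\<And>i s q. s > 0 \<Longrightarrow> 0 < q \<Longrightarrow> q < 1 \<Longrightarrow> degree (P i s q) = i"
    and orthonormal: "\<And>i j s q. s > 0 \<Longrightarrow> 0 < q \<Longrightarrow> q < 1 \<Longrightarrow>
          (\<lambda>k. poly (P i s q) (real k) * poly (P j s q) (real k) * weight \<nu> s q k)
            sums (if i = j then 1 else 0)"
    and smooth: "\<And>i j. C1_on (\<lambda>(s, q). coeff (P i s q) j) ({0<..} \<times> {0<..<1})"
    and t: "t > 0" and lam: "0 < lam" "lam < 1" and n: "n \<ge> 1"
  shows "\<forall>x::real.
    summable (\<lambda>k. deriv (\<lambda>s. poly (P n s lam) (real k)) t * (real k * weight \<nu> t lam k)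
                  * poly (bracket_quot (\<lambda>i. P i t lam) (n - 1) (real k - 1)) x) \<and>
    poly (P n t lam) (x + 1) =
      poly (P n t lam) x
      + rec_A (\<lambda>i. P i t lam) n / (lam * lead_coeff (P n t lam))
        * deriv (\<lambda>s. lead_coeff (P n s lam)) t * poly (P (n - 1) t lam) x
      + 1 / lam *
        (\<Sum>k. deriv (\<lambda>s. poly (P n s lam) (real k)) t * (real k * weight \<nu> t lam k)
              * poly (bracket_quot (\<lambda>i. P i t lam) (n - 1) (real k - 1)) x)"
proof
  fix x :: real
  have ops: "orthonormal_polys (\<lambda>i. P i s lam) (weight \<nu> s lam)" if "s > 0" for s
    by (rule orthonormal_polys.intro[OF deg[OF that lam] orthonormal[OF that lam]])
  define L where "L s q = (\<Sum>k. poly q (real k) * weight \<nu> s lam k)" for s q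
  have L_eq: "orthonormal_polys.L (weight \<nu> s lam) = L s" if "s > 0" for s
    using orthonormal_polys.L_def[OF ops[OF that]] by (simp add: L_def fun_eq_iff)
  interpret T: orthonormal_polys "\<lambda>i. P i t lam" "weight \<nu> t lam"
    rewrites "orthonormal_polys.L (weight \<nu> t lam) = L t"
    using ops[OF t] L_eq[OF t] by simp_all
  define p where "p i = P i t lam" for i
  \<comment> \<open>\<open>D\<close> is \<open>\<partial>P\<^sub>n/\<partial>t\<close> at \<open>t\<close>, taken coefficient by coefficient. The test polynomials \<open>r j\<close> keep
    \<open>t\<close> fixed while the weight and \<open>P\<^sub>n\<close> vary.\<close>
  define D where "D = (\<Sum>i\<le>n. monom (deriv (\<lambda>s. coeff (P n s lam) i) t) i)"
  define r where "r j = [:0, 1:] * pcompose (p j) [:-1, 1:]" for j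
  have coeff_D: "coeff D i = (if i \<le> n then deriv (\<lambda>s. coeff (P n s lam) i) t else 0)" for i
    by (simp add: D_def coeff_sum)
  then have degree_D: "degree D \<le> n"
    by (intro degree_le) auto
  have coeff_deriv: "((\<lambda>s. coeff (P n s lam) i) has_real_derivative coeff D i) (at t)" if "i \<le> n" for i
    using C1_on_partial_derivative[OF smooth[of n i], of t lam] t lam that
    by (simp add: coeff_D DERIV_deriv_iff_real_differentiable)
  have D_deriv: "deriv (\<lambda>s. poly (P n s lam) y) t = poly D y" for y
  proof (rule DERIV_imp_deriv)
    have "((\<lambda>s. \<Sum>i\<le>n. coeff (P n s lam) i * y ^ i) has_real_derivative (\<Sum>i\<le>n. coeff D i * y ^ i)) (at t)"
      by (intro DERIV_sum DERIV_cmult_right coeff_deriv) auto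
    moreover have "(\<Sum>i\<le>n. coeff D i * y ^ i) = poly D y"
      by (simp add: D_def poly_sum poly_monom coeff_sum)
    ultimately have "((\<lambda>s. \<Sum>i\<le>n. coeff (P n s lam) i * y ^ i) has_real_derivative poly D y) (at t)"
      by simp
    then show "((\<lambda>s. poly (P n s lam) y) has_real_derivative poly D y) (at t)"
      by (rule has_field_derivative_transform_within_open[of _ _ _ "{0<..}"])
         (use t deg lam in \<open>auto simp: poly_altdef\<close>)
  qed
  have lead_deriv: "deriv (\<lambda>s. lead_coeff (P n s lam)) t = coeff D n"
  proof -
    have "eventually (\<lambda>s. s \<in> {0<..}) (nhds t)"
      using t by (intro eventually_nhds_in_open) auto
    then have "eventually (\<lambda>s. lead_coeff (P n s lam) = coeff (P n s lam) n) (nhds t)"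
      by eventually_elim (simp add: deg lam)
    then show ?thesis by (simp add: deriv_cong_ev coeff_D)
  qed
  have coeff_r: "coeff (r j) n = (if j = n - 1 then coeff (p (n - 1)) (n - 1) else 0)"
    and degree_r: "degree (r j) \<le> n" if "j < n" for j
  proof -
    let ?q = "pcompose (p j) [:-1, 1:]"
    have q: "degree ?q = j"
      using T.degree_p by (simp add: degree_pcompose p_def)
    have "coeff ?q j = coeff (p j) j"
      using lead_coeff_comp[of "[:-1, 1:]" "p j"] q T.degree_p by (simp add: p_def)
    moreover obtain m where m: "n = Suc m" using n by (cases n) auto
    ultimately show "coeff (r j) n = (if j = n - 1 then coeff (p (n - 1)) (n - 1) else 0)"
      using q that by (auto simp: r_def coeff_eq_0)
    show "degree (r j) \<le> n"
      using q that degree_mult_le[of "[:0, 1:]" ?q] by (simp add: r_def)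
  qed
  \<comment> \<open>The two evaluations of the derivative of \<open>s \<mapsto> L s (P\<^sub>n(s) * r j)\<close>: \<open>F1\<close> from its closed form,
    \<open>F2\<close> from the product rule.\<close>
  have key: "lam * L t (pcompose (p n) [:1, 1:] * p j)
      = L t (D * r j) + coeff (r j) n * coeff D n / coeff (p n) n ^ 2" if j: "j < n" for j
  proof -
    let ?q = "\<lambda>i. monom 1 i * pcompose (p j) [:-1, 1:]"
    have monom_r: "monom 1 i * r j = [:0, 1:] * ?q i" for i
      unfolding r_def by (rule mult.left_commute)
    let ?F = "\<lambda>s. L s (P n s lam * r j)"
    \<comment> \<open>\<open>?F s = [x\<^sup>n] (r j) / a\<^sub>n(s)\<close> by orthogonality, because \<open>degree (r j) \<le> n\<close>.\<close>
    have F0: "((\<lambda>s. coeff (r j) n / coeff (P n s lam) n) has_real_derivative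
        - (coeff (r j) n * coeff D n / coeff (p n) n ^ 2)) (at t)"
      using T.lead_coeff_nonzero[of n]
      by (auto intro!: derivative_eq_intros coeff_deriv simp: p_def power2_eq_square)
    have F_eq: "coeff (r j) n / coeff (P n s lam) n = ?F s" if s: "s \<in> {0<..}" for s
    proof -
      interpret S: orthonormal_polys "\<lambda>i. P i s lam" "weight \<nu> s lam"
        rewrites "orthonormal_polys.L (weight \<nu> s lam) = L s"
        using s ops L_eq by simp_all
      show ?thesis
        using S.L_mult_p[OF degree_r[OF j]] by (simp add: mult.commute)
    qed
    have F1: "(?F has_real_derivative - (coeff (r j) n * coeff D n / coeff (p n) n ^ 2)) (at t)"
      by (rule has_field_derivative_transform_within_open[OF F0 open_greaterThan _ F_eq]) (use t in auto)
    \<comment> \<open>Expanding \<open>P\<^sub>n(s)\<close> in monomials separates the dependence on \<open>s\<close> of its coefficients from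
      that of the weight.\<close>
    have moment: "((\<lambda>s. L s ([:0, 1:] * ?q i)) has_real_derivative
        - lam * L t (pcompose (?q i) [:1, 1:])) (at t)" for i
      unfolding L_def
      by (intro moment_has_derivative nu lam t orthonormal_polys.poly_summable[OF ops])
    have "((\<lambda>s. \<Sum>i\<le>n. coeff (P n s lam) i * L s ([:0, 1:] * ?q i)) has_real_derivative
        (\<Sum>i\<le>n. coeff D i * L t ([:0, 1:] * ?q i)
          + - lam * L t (pcompose (?q i) [:1, 1:]) * coeff (P n t lam) i)) (at t)"
      by (intro DERIV_sum DERIV_mult coeff_deriv moment) auto
    then have F2: "(?F has_real_derivative
        (\<Sum>i\<le>n. coeff D i * L t ([:0, 1:] * ?q i)
          + - lam * L t (pcompose (?q i) [:1, 1:]) * coeff (P n t lam) i)) (at t)"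
    proof (rule has_field_derivative_transform_within_open[of _ _ _ "{0<..}"])
      fix s :: real assume s: "s \<in> {0<..}"
      interpret S: orthonormal_polys "\<lambda>i. P i s lam" "weight \<nu> s lam"
        rewrites "orthonormal_polys.L (weight \<nu> s lam) = L s"
        using s ops L_eq by simp_all
      have P_r: "P n s lam * r j = (\<Sum>i\<le>n. smult (coeff (P n s lam) i) ([:0, 1:] * ?q i))"
        using s mult_as_sum_of_monoms[of "P n s lam" n "r j"] deg[of s lam n] lam
        by (simp only: monom_r greaterThan_iff order_refl)
      then show "(\<Sum>i\<le>n. coeff (P n s lam) i * L s ([:0, 1:] * ?q i)) = ?F s"
        by (simp only: P_r S.L_sum S.L_smult)
    qed (use t in auto)
    \<comment> \<open>Reassembling the monomials: the derivatives of the coefficients give \<open>D\<close>, and the shift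
      \<open>x \<mapsto> x + 1\<close> coming from the weight turns \<open>P\<^sub>j(x - 1)\<close> back into \<open>P\<^sub>j(x)\<close>.\<close>
    have D_part: "(\<Sum>i\<le>n. coeff D i * L t ([:0, 1:] * ?q i)) = L t (D * r j)"
    proof -
      have "D * r j = (\<Sum>i\<le>n. smult (coeff D i) ([:0, 1:] * ?q i))"
        using mult_as_sum_of_monoms[OF degree_D, of "r j"] by (simp only: monom_r)
      then show ?thesis by (simp only: T.L_sum T.L_smult)
    qed
    have weight_part: "(\<Sum>i\<le>n. L t (pcompose (?q i) [:1, 1:]) * coeff (P n t lam) i)
        = L t (pcompose (p n) [:1, 1:] * p j)"
    proof -
      have "pcompose (pcompose (p j) [:-1, 1:]) [:1, 1:] = p j"
        by (simp add: pcompose_assoc[symmetric] pcompose_pCons pcompose_idR)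
      then have "pcompose (p n) [:1, 1:] * p j
          = pcompose (p n * pcompose (p j) [:-1, 1:]) [:1, 1:]"
        by (simp add: pcompose_mult)
      also have "p n * pcompose (p j) [:-1, 1:] = (\<Sum>i\<le>n. smult (coeff (P n t lam) i) (?q i))"
        unfolding p_def[of n] using T.degree_p by (intro mult_as_sum_of_monoms) simp
      finally show ?thesis
        by (simp add: pcompose_sum pcompose_smult T.L_sum T.L_smult mult.commute)
    qed
    have "L t (D * r j) + - lam * L t (pcompose (p n) [:1, 1:] * p j)
        = - (coeff (r j) n * coeff D n / coeff (p n) n ^ 2)"
      using DERIV_unique[OF F2 F1]
      by (simp only: sum.distrib mult.assoc sum_distrib_left[symmetric] D_part weight_part)
    then show ?thesis by simp
  qed
  let ?term = "\<lambda>k. deriv (\<lambda>s. poly (P n s lam) (real k)) t * (real k * weight \<nu> t lam k)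
      * poly (bracket_quot (\<lambda>i. P i t lam) (n - 1) (real k - 1)) x"
  have term_eq: "?term k = poly (\<Sum>j<n. smult (poly (p j) x) (D * r j)) (real k) * weight \<nu> t lam k" for k
  proof -
    have "{..n - 1} = {..<n}" using n by auto
    then show ?thesis
      by (simp add: D_deriv T.bracket_quot_kernel p_def r_def poly_sum poly_pcompose
          sum_distrib_left sum_distrib_right mult_ac)
  qed
  have series: "(\<Sum>k. ?term k) = (\<Sum>j<n. poly (p j) x * L t (D * r j))"
    unfolding term_eq by (simp add: T.L_sum T.L_smult flip: L_def)
  have "poly (p n) (x + 1) = poly (p n) x + (\<Sum>j<n. L t (pcompose (p n) [:1, 1:] * p j) * poly (p j) x)"
    using arg_cong[OF T.shift_expansion[of n], of "\<lambda>q. poly q x"]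
    by (simp add: p_def poly_pcompose poly_sum add.commute)
  also have "(\<Sum>j<n. L t (pcompose (p n) [:1, 1:] * p j) * poly (p j) x)
      = (\<Sum>j<n. 1 / lam * (coeff (r j) n * coeff D n / coeff (p n) n ^ 2) * poly (p j) x)
        + 1 / lam * (\<Sum>j<n. poly (p j) x * L t (D * r j))"
    unfolding sum_distrib_left sum.distrib[symmetric]
  proof (rule sum.cong[OF refl])
    fix j assume "j \<in> {..<n}"
    then have "L t (pcompose (p n) [:1, 1:] * p j)
        = (L t (D * r j) + coeff (r j) n * coeff D n / coeff (p n) n ^ 2) / lam"
      using key[of j] lam by (simp add: field_simps)
    then show "L t (pcompose (p n) [:1, 1:] * p j) * poly (p j) x
        = 1 / lam * (coeff (r j) n * coeff D n / coeff (p n) n ^ 2) * poly (p j) x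
          + 1 / lam * (poly (p j) x * L t (D * r j))"
      by (simp add: algebra_simps add_divide_distrib)
  qed
  \<comment> \<open>Only \<open>r (n - 1)\<close> has degree \<open>n\<close>.\<close>
  also have "(\<Sum>j<n. 1 / lam * (coeff (r j) n * coeff D n / coeff (p n) n ^ 2) * poly (p j) x)
      = (\<Sum>j\<in>{n - 1}. 1 / lam * (coeff (r j) n * coeff D n / coeff (p n) n ^ 2) * poly (p j) x)"
    using n by (intro sum.mono_neutral_right) (auto simp: coeff_r)
  also have "\<dots> = rec_A (\<lambda>i. P i t lam) n / (lam * coeff (p n) n) * coeff D n * poly (p (n - 1)) x"
  proof -
    obtain m where m: "n = Suc m" using n by (cases n) auto
    show ?thesis
      using T.rec_A_Suc[of m] coeff_r[of m] by (simp add: m p_def power2_eq_square)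
  qed
  finally have "poly (P n t lam) (x + 1) = poly (P n t lam) x
      + rec_A (\<lambda>i. P i t lam) n / (lam * lead_coeff (P n t lam))
        * deriv (\<lambda>s. lead_coeff (P n s lam)) t * poly (P (n - 1) t lam) x
      + 1 / lam * (\<Sum>k. ?term k)"
    by (simp only: lead_deriv series p_def T.degree_p add.assoc)
  moreover have "summable ?term"
    unfolding term_eq by (rule T.poly_summable)
  ultimately show "summable ?term \<and> poly (P n t lam) (x + 1) = poly (P n t lam) x
      + rec_A (\<lambda>i. P i t lam) n / (lam * lead_coeff (P n t lam))
        * deriv (\<lambda>s. lead_coeff (P n s lam)) t * poly (P (n - 1) t lam) x
      + 1 / lam * (\<Sum>k. ?term k)"
    by blast
qed

end
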